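(* Let $n\geq 6$, and let $\alpha_n$ be an optimal set of $n$-means for the probability measure $P=\frac1{2^3}\delta_1+\frac1{2^2}\delta_2+\frac12\delta_3+\sum_{j=4}^\infty\frac1{2^j}\delta_j$. Then $\alpha_n$ must contain the set $\{1,2,\dots,n-3\}$.
   Context: $\delta_x$ denotes the Dirac measure at $x\in\mathbb R$. For a Borel probability measure $P$ on $\mathbb R$ and a nonempty finite set $\alpha\subset\mathbb R$, the distortion error is $V(P;\alpha)=\int\min_{a\in\alpha}|x-a|^2\,dP(x)$. The $n$th quantization error is $V_n(P)=\inf\{V(P;\alpha):\alpha\subset\mathbb R,\ 1\le\mathrm{card}(\alpha)\le n\}$. An optimal set of $n$-means for $P$ is a set $\alpha$ with at most $n$ points for which this infimum is attained. *)

theory Defs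
  imports "HOL-Probability.Probability"
begin

definition distortion_error :: "real measure \<Rightarrow> real set \<Rightarrow> ennreal" where
  "distortion_error P \<alpha> = (\<integral>\<^sup>+ x. ennreal (MIN a\<in>\<alpha>. \<bar>x - a\<bar>\<^sup>2) \<partial>P)"

definition quantization_error :: "nat \<Rightarrow> real measure \<Rightarrow> ennreal" where
  "quantization_error n P =
     (INF \<alpha> \<in> {\<alpha>. finite \<alpha> \<and> 1 \<le> card \<alpha> \<and> card \<alpha> \<le> n}. distortion_error P \<alpha>)"

definition optimal_n_means :: "nat \<Rightarrow> real measure \<Rightarrow> real set \<Rightarrow> bool" where
  "optimal_n_means n P \<alpha> \<longleftrightarrow>
     finite \<alpha> \<and> 1 \<le> card \<alpha> \<and> card \<alpha> \<le> n \<and> distortion_error P \<alpha> = quantization_error n P"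

abbreviation dirac :: "real \<Rightarrow> real measure" where
  "dirac x \<equiv> return borel x"

definition P_content :: "real set \<Rightarrow> ennreal" where
  "P_content A =
     ennreal (1 / 2 ^ 3) * emeasure (dirac 1) A
     + ennreal (1 / 2 ^ 2) * emeasure (dirac 2) A
     + ennreal (1 / 2) * emeasure (dirac 3) A
     + (\<Sum>i. ennreal (1 / 2 ^ (i + 4)) * emeasure (dirac (real (i + 4))) A)"

definition P_measure :: "real measure" where
  "P_measure = measure_of UNIV (sets borel) P_content"

text \<open>\<^const>\<open>measure_of\<close> would silently return the null measure if the set function were not
  countably additive; the following facts exclude this.\<close>

lemma sets_P_measure [simp, measurable_cong]: "sets P_measure = sets borel"
  unfolding P_measure_def by (metis sets.sigma_sets_eq sets_measure_of space_borel subset_UNIV Pow_UNIV)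

lemma space_P_measure [simp]: "space P_measure = UNIV"
  using sets_eq_imp_space_eq[OF sets_P_measure] by simp

lemma countably_additive_P_content: "countably_additive (sets borel) P_content"
proof (rule countably_additiveI)
  fix A :: "nat \<Rightarrow> real set"
  assume A: "range A \<subseteq> sets borel" "disjoint_family A"
  have D: "(\<Sum>k. emeasure (dirac x) (A k)) = emeasure (dirac x) (\<Union>k. A k)" for x
    using A by (intro suminf_emeasure) auto
  have S: "(\<Sum>k. \<Sum>i. f i k) = (\<Sum>i. \<Sum>k. f i k)" for f :: "nat \<Rightarrow> nat \<Rightarrow> ennreal"
    using nn_integral_fst_count_space[of "\<lambda>(k, i). f i k"]
      nn_integral_snd_count_space[of "\<lambda>(k, i). f i k"]
    by (simp flip: nn_integral_count_space_nat)
  show "(\<Sum>k. P_content (A k)) = P_content (\<Union>k. A k)"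
    unfolding P_content_def
    by (simp only: suminf_add[symmetric] summableI S ennreal_suminf_cmult D)
qed

lemma emeasure_P_measure:
  assumes "A \<in> sets borel"
  shows "emeasure P_measure A = P_content A"
proof -
  have "emeasure P_measure A = P_content A"
    unfolding P_measure_def
  proof (rule emeasure_measure_of_sigma)
    show "sigma_algebra UNIV (sets (borel :: real measure))"
      using sets.sigma_algebra_axioms[of "borel :: real measure"] by simp
    show "positive (sets borel) P_content"
      by (simp add: positive_def P_content_def)
  qed (use countably_additive_P_content assms in auto)
  then show ?thesis .
qed

lemma prob_space_P_measure: "prob_space P_measure"
proof
  have *: "(\<lambda>i. (1 / 2) ^ 3 * (1 / 2) ^ Suc i :: real) sums ((1 / 2) ^ 3 * 1)"
    by (intro sums_mult power_half_series)
  have "(\<lambda>i. 1 / 2 ^ (i + 4) :: real) sums (1 / 8)"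
    using * by (simp add: power_add power_divide mult.commute)
  then have tail: "(\<Sum>i. ennreal (1 / 2 ^ (i + 4))) = ennreal (1 / 8)"
    by (intro sums_unique[symmetric]) (simp add: sums_ennreal)
  have "emeasure P_measure (space P_measure)
      = ennreal (1 / 2 ^ 3) + ennreal (1 / 2 ^ 2) + ennreal (1 / 2)
        + (\<Sum>i. ennreal (1 / 2 ^ (i + 4)))"
    by (simp only: space_P_measure emeasure_P_measure P_content_def emeasure_return
          space_in_borel indicator_UNIV mult_1_right)
  also have "\<dots> = ennreal (1 / 2 ^ 3 + 1 / 2 ^ 2 + 1 / 2 + 1 / 8)"
    unfolding tail by (simp only: ennreal_plus add_nonneg_nonneg zero_le_divide_1_iff
          zero_le_power zero_le_numeral)
  finally show "emeasure P_measure (space P_measure) = 1"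
    by simp
qed

end

(*
  The set {1,...,n-2} together with n - 2/3 (the centroid of the atoms n-1 and n) and n + 2 (the
  centroid of all atoms above n) has distortion (8/3) 2^(-n), which bounds the optimal error.
  If an atom k <= n-3 is missing from an optimal set, then the point serving k must serve another
  atom too (else moving it to k would be an improvement), hence also an atom m adjacent to k.
  Serving two adjacent atoms of masses p and q by one point costs at least p q / (p + q), which is
  at least (8/3) 2^(-n) for a pair containing k. Since a finite set also misses infinitely many
  atoms of positive mass, the error strictly exceeds (8/3) 2^(-n), a contradiction.
*)
theory Submission
  imports Defs
begin

section \<open>The measure as a weighted counting measure\<close>

definition mass :: "nat \<Rightarrow> real" where
  "mass j = (if j = 0 then 0 else if j = 1 then 1 / 8 else if j = 2 then 1 / 4
     else if j = 3 then 1 / 2 else 1 / 2 ^ j)"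

lemma mass_nonneg [simp]: "0 \<le> mass j"
  by (simp add: mass_def)

lemma mass_pos: "1 \<le> j \<Longrightarrow> 0 < mass j"
  by (simp add: mass_def)

lemma mass_0 [simp]: "mass 0 = 0"
  by (simp add: mass_def)

lemma mass_tail: "4 \<le> j \<Longrightarrow> mass j = 1 / 2 ^ j"
  by (simp add: mass_def)

lemma P_content_eq_suminf:
  "P_content A = (\<Sum>j. ennreal (mass j) * indicator A (real j))" if "A \<in> sets borel"
proof -
  have "(\<Sum>j. ennreal (mass j) * indicator A (real j)) =
      (\<Sum>j. ennreal (mass (j + 4)) * indicator A (real (j + 4))) +
      (\<Sum>j<4. ennreal (mass j) * indicator A (real j))"
    by (rule suminf_offset) simp
  also have "(\<Sum>j<4. ennreal (mass j) * indicator A (real j)) =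
      ennreal (1 / 8) * indicator A 1 + ennreal (1 / 4) * indicator A 2 +
      ennreal (1 / 2) * indicator A 3"
  proof -
    have four: "{..<4::nat} = {0, 1, 2, 3}" by auto
    have "(\<Sum>j<4. f j) = f 1 + f 2 + f 3" if "f 0 = 0" for f :: "nat \<Rightarrow> ennreal"
      unfolding four using that by (simp add: add.assoc)
    from this[of "\<lambda>j. ennreal (mass j) * indicator A (real j)"] show ?thesis
      by (simp add: mass_def[of "Suc 0"] mass_def[of 2] mass_def[of 3] del: sum_mult_indicator)
  qed
  also have "(\<Sum>j. ennreal (mass (j + 4)) * indicator A (real (j + 4))) =
      (\<Sum>j. ennreal (1 / 2 ^ (j + 4)) * emeasure (dirac (real (j + 4))) A)"
    using that by (simp only: mass_tail le_add2 emeasure_return)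
  finally show ?thesis
    using that by (simp add: P_content_def add.commute)
qed

text \<open>As an image of a weighted counting measure on \<open>nat\<close>, the measure turns
  integrals into series. The convention \<open>mass 0 = 0\<close> lets the index range over all of
  \<open>nat\<close> without adding an atom at 0.\<close>

lemma P_measure_eq_distr:
  "P_measure = distr (density (count_space UNIV) (\<lambda>j. ennreal (mass j))) borel real"
proof (rule measure_eqI)
  fix A assume "A \<in> sets P_measure"
  then have A: "A \<in> sets borel" by simp
  have "emeasure (distr (density (count_space UNIV) (\<lambda>j. ennreal (mass j))) borel real) A =
      (\<integral>\<^sup>+ j. ennreal (mass j) * indicator (real -` A) j \<partial>count_space UNIV)"
    using A by (subst emeasure_distr) (auto simp: emeasure_density)
  also have "\<dots> = P_content A"
    using A by (simp add: nn_integral_count_space_nat P_content_eq_suminf indicator_vimage)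
  finally show "emeasure P_measure A =
      emeasure (distr (density (count_space UNIV) (\<lambda>j. ennreal (mass j))) borel real) A"
    using A by (simp add: emeasure_P_measure)
qed simp

section \<open>Squared distance to a finite set, and distortion as a series\<close>

definition sq_dist :: "real set \<Rightarrow> real \<Rightarrow> real" where
  "sq_dist \<alpha> x = (MIN a\<in>\<alpha>. \<bar>x - a\<bar>\<^sup>2)"

lemma sq_dist_le: "finite \<alpha> \<Longrightarrow> a \<in> \<alpha> \<Longrightarrow> sq_dist \<alpha> x \<le> (x - a)\<^sup>2"
  unfolding sq_dist_def by (subst power2_abs[symmetric], rule Min_le) auto

lemma sq_dist_attained:
  assumes "finite \<alpha>" "\<alpha> \<noteq> {}"
  obtains a where "a \<in> \<alpha>" "sq_dist \<alpha> x = (x - a)\<^sup>2"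
proof -
  have "sq_dist \<alpha> x \<in> (\<lambda>a. \<bar>x - a\<bar>\<^sup>2) ` \<alpha>"
    unfolding sq_dist_def using assms by (intro Min_in) auto
  then show ?thesis using that by auto
qed

lemma sq_dist_nonneg: "finite \<alpha> \<Longrightarrow> \<alpha> \<noteq> {} \<Longrightarrow> 0 \<le> sq_dist \<alpha> x"
  by (rule sq_dist_attained[of \<alpha> x]) auto

lemma sq_dist_pos: "finite \<alpha> \<Longrightarrow> \<alpha> \<noteq> {} \<Longrightarrow> x \<notin> \<alpha> \<Longrightarrow> 0 < sq_dist \<alpha> x"
  by (rule sq_dist_attained[of \<alpha> x]) auto

lemma sq_dist_nearest:
  assumes "finite \<alpha>" "a \<in> \<alpha>" "\<And>b. b \<in> \<alpha> \<Longrightarrow> \<bar>x - a\<bar> \<le> \<bar>x - b\<bar>"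
  shows "sq_dist \<alpha> x = (x - a)\<^sup>2"
proof -
  obtain b where "b \<in> \<alpha>" "sq_dist \<alpha> x = (x - b)\<^sup>2"
    using sq_dist_attained[of \<alpha> x] assms by auto
  with assms(3)[of b] sq_dist_le[OF assms(1,2), of x] show ?thesis
    by (simp add: abs_le_square_iff)
qed

lemma borel_measurable_sq_dist [measurable]:
  assumes "finite \<alpha>" "\<alpha> \<noteq> {}"
  shows "sq_dist \<alpha> \<in> borel_measurable borel"
  using assms
proof (induction rule: finite_ne_induct)
  case (singleton a)
  then show ?case unfolding sq_dist_def by simp
next
  case (insert a \<alpha>)
  then have "sq_dist (insert a \<alpha>) = (\<lambda>x. min (\<bar>x - a\<bar>\<^sup>2) (sq_dist \<alpha> x))"
    unfolding sq_dist_def by simp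
  with insert.IH show ?case by simp
qed

lemma distortion_error_P_measure:
  assumes "finite \<alpha>" "\<alpha> \<noteq> {}"
  shows "distortion_error P_measure \<alpha> = (\<Sum>j. ennreal (mass j * sq_dist \<alpha> (real j)))"
proof -
  have [measurable]: "sq_dist \<alpha> \<in> borel_measurable borel"
    using assms by measurable
  have "distortion_error P_measure \<alpha> = (\<integral>\<^sup>+ x. ennreal (sq_dist \<alpha> x) \<partial>P_measure)"
    by (simp add: distortion_error_def sq_dist_def)
  also have "\<dots> = (\<Sum>j. ennreal (mass j) * ennreal (sq_dist \<alpha> (real j)))"
    by (simp add: P_measure_eq_distr nn_integral_distr nn_integral_density
        nn_integral_count_space_nat)
  finally show ?thesis
    using assms by (simp add: ennreal_mult sq_dist_nonneg)
qed

text \<open>Dropping nonnegative terms of the series leaves a finite real sum, so the cost of a few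
  selected atoms bounds the error from below.\<close>

lemma distortion_error_ge_sum:
  assumes "finite \<alpha>" "\<alpha> \<noteq> {}" "finite J"
  shows "ennreal (\<Sum>j\<in>J. mass j * sq_dist \<alpha> (real j)) \<le> distortion_error P_measure \<alpha>"
proof -
  have "ennreal (\<Sum>j\<in>J. mass j * sq_dist \<alpha> (real j)) =
      (\<Sum>j\<in>J. ennreal (mass j * sq_dist \<alpha> (real j)))"
    using assms by (intro sum_ennreal[symmetric]) (simp add: sq_dist_nonneg)
  also have "\<dots> \<le> (\<Sum>j. ennreal (mass j * sq_dist \<alpha> (real j)))"
    using assms by (intro sum_le_suminf) auto
  finally show ?thesis
    by (simp add: distortion_error_P_measure assms)
qed

section \<open>Upper bound for the optimal error\<close>

lemma quantization_error_le:
  assumes "finite \<beta>" "\<beta> \<noteq> {}" "card \<beta> \<le> n"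
  shows "quantization_error n P \<le> distortion_error P \<beta>"
  unfolding quantization_error_def
  using assms by (intro INF_lower) (auto simp: Suc_le_eq card_gt_0_iff)

text \<open>The weights \<open>1 / 2 ^ (i + 1)\<close> form a geometric distribution with mean 1,
  and the sum is its variance.\<close>

lemma shifted_square_half_sums: "(\<lambda>i. (real i - 1)\<^sup>2 / 2 ^ (i + 1)) sums 2"
proof -
  \<comment> \<open>Chosen so that the series telescopes:
    \<open>(i^2 + 2) - ((i + 1)^2 + 2) / 2 = (i - 1)^2 / 2\<close>. The limit 0 and
    \<open>T 0 = 2\<close> give the sum.\<close>
  define T where "T = (\<lambda>i::nat. ((real i)\<^sup>2 + 2) / 2 ^ i)"
  have "T \<longlonglongrightarrow> 0"
    unfolding T_def by real_asymp
  then have "(\<lambda>i. T i - T (Suc i)) sums (T 0 - 0)"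
    by (rule telescope_sums')
  moreover have "T i - T (Suc i) = (real i - 1)\<^sup>2 / 2 ^ (i + 1)" for i
    by (simp add: T_def field_simps power2_eq_square)
  ultimately show ?thesis by (simp add: T_def)
qed

text \<open>The bound is the sum of \<open>2 / 3 / 2 ^ n\<close> for the atoms \<open>n - 1\<close>
  and \<open>n\<close> and \<open>2 / 2 ^ n\<close> for the tail beyond \<open>n\<close>; the
  smaller atoms cost nothing.\<close>

lemma quantization_error_P_measure_le:
  assumes "6 \<le> n"
  shows "quantization_error n P_measure \<le> ennreal (8 / 3 / 2 ^ n)"
proof -
  define \<beta> where "\<beta> = insert (real n - 2 / 3) (insert (real n + 2) (real ` {1..n - 2}))"
  have fin: "finite \<beta>" "\<beta> \<noteq> {}" by (auto simp: \<beta>_def)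
  have "card \<beta> \<le> Suc (Suc (card (real ` {1..n - 2})))"
    by (simp add: \<beta>_def card_insert_if)
  also have "card (real ` {1..n - 2}) = n - 2"
    by (simp add: card_image)
  finally have card: "card \<beta> \<le> n" using assms by simp
  \<comment> \<open>The cost of atom \<open>j\<close> when assigned to its intended point of
    \<open>\<beta>\<close>. The true cost is at most this, so no nearest point has to be
    determined.\<close>
  define g where "g j = (if j \<le> n - 2 then 0
      else if j = n - 1 then 1 / 2 ^ j * (1 / 9)
      else if j = n then 1 / 2 ^ j * (4 / 9)
      else 1 / 2 ^ j * (real j - (real n + 2))\<^sup>2)" for j
  \<comment> \<open>With \<open>j = n + 1 + i\<close>, the signed distance to \<open>n + 2\<close>
    is \<open>i - 1\<close> and the mass is \<open>1 / 2 ^ n\<close> times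
    \<open>1 / 2 ^ (i + 1)\<close>.\<close>
  have tail: "g (i + (n + 1)) = 1 / 2 ^ n * ((real i - 1)\<^sup>2 / 2 ^ (i + 1))" for i
    by (simp add: g_def power_add field_simps) arith
  have head: "(\<Sum>i<n + 1. g i) = 2 / 3 / 2 ^ n"
  proof -
    obtain m where m: "n = Suc m" using assms by (cases n) auto
    have "(\<Sum>i<m. g i) = 0" by (intro sum.neutral) (auto simp: g_def m)
    then show ?thesis using assms by (simp add: m) (simp add: g_def m field_simps)
  qed
  have "(\<lambda>i. g (i + (n + 1))) sums (1 / 2 ^ n * 2)"
    unfolding tail by (intro sums_mult shifted_square_half_sums)
  then have "g sums (1 / 2 ^ n * 2 + (\<Sum>i<n + 1. g i))"
    using sums_iff_shift[of g "n + 1"] by blast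
  then have g: "g sums (8 / 3 / 2 ^ n)"
    unfolding head by simp
  have le: "mass j * sq_dist \<beta> (real j) \<le> g j" for j
  proof -
    consider "j = 0" | "1 \<le> j" "j \<le> n - 2" | "j = n - 1" | "j = n" | "n < j"
      by linarith
    then show ?thesis
    proof cases
      case 1
      then show ?thesis by (simp add: g_def)
    next
      case 2
      then have "sq_dist \<beta> (real j) \<le> (real j - real j)\<^sup>2"
        by (intro sq_dist_le) (auto simp: \<beta>_def)
      with 2 show ?thesis by (simp add: g_def mult_nonneg_nonpos)
    next
      case 3
      then have "sq_dist \<beta> (real j) \<le> (real j - (real n - 2 / 3))\<^sup>2"
        by (intro sq_dist_le) (auto simp: \<beta>_def)
      also have "\<dots> = 1 / 9" using 3 assms by (simp add: of_nat_diff power2_eq_square)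
      finally have "mass j * sq_dist \<beta> (real j) \<le> mass j * (1 / 9)"
        by (intro mult_left_mono) auto
      moreover have "\<not> j \<le> n - 2" "4 \<le> j" using 3 assms by linarith+
      then have "g j = mass j * (1 / 9)" using 3 by (simp add: g_def mass_tail)
      ultimately show ?thesis by simp
    next
      case 4
      then have "sq_dist \<beta> (real j) \<le> (real j - (real n - 2 / 3))\<^sup>2"
        by (intro sq_dist_le) (auto simp: \<beta>_def)
      also have "\<dots> = 4 / 9" using 4 assms by (simp add: power2_eq_square)
      finally have "mass j * sq_dist \<beta> (real j) \<le> mass j * (4 / 9)"
        by (intro mult_left_mono) auto
      moreover have "\<not> j \<le> n - 2" "j \<noteq> n - 1" "4 \<le> j" using 4 assms by linarith+
      then have "g j = mass j * (4 / 9)" using 4 by (simp add: g_def mass_tail)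
      ultimately show ?thesis by simp
    next
      case 5
      then have "sq_dist \<beta> (real j) \<le> (real j - (real n + 2))\<^sup>2"
        by (intro sq_dist_le) (auto simp: \<beta>_def)
      then have "mass j * sq_dist \<beta> (real j) \<le> mass j * (real j - (real n + 2))\<^sup>2"
        by (intro mult_left_mono) auto
      moreover have "\<not> j \<le> n - 2" "j \<noteq> n - 1" "j \<noteq> n" "4 \<le> j" using 5 assms by linarith+
      then have "g j = mass j * (real j - (real n + 2))\<^sup>2" by (simp add: g_def mass_tail)
      ultimately show ?thesis by simp
    qed
  qed
  have nonneg: "0 \<le> g j" for j by (simp add: g_def)
  have "distortion_error P_measure \<beta> \<le> (\<Sum>j. ennreal (g j))"
    unfolding distortion_error_P_measure[OF fin] by (intro suminf_le ennreal_leI le) auto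
  also have "\<dots> = ennreal (8 / 3 / 2 ^ n)"
    using g nonneg by (intro sums_unique[symmetric]) (simp add: sums_ennreal)
  finally show ?thesis
    using quantization_error_le[OF fin card, of P_measure] by (rule order.trans[rotated])
qed

section \<open>Cost of serving two adjacent atoms by one point\<close>

lemma pair_cost_ge:
  fixes p q u :: real
  assumes "0 < p" "0 < q"
  shows "p * q / (p + q) \<le> p * u\<^sup>2 + q * (u + 1)\<^sup>2"
proof -
  \<comment> \<open>Completing the square in \<open>u\<close>; the minimum
    \<open>u = - q / (p + q)\<close> corresponds to placing the point at the centroid.\<close>
  have "(p * u\<^sup>2 + q * (u + 1)\<^sup>2) * (p + q) = p * q + ((p + q) * u + q)\<^sup>2"
    by (simp add: power2_eq_square algebra_simps)
  then have "p * q \<le> (p * u\<^sup>2 + q * (u + 1)\<^sup>2) * (p + q)"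
    by simp
  with assms show ?thesis by (simp add: pos_divide_le_eq)
qed

text \<open>For \<open>4 \<le> m\<close> the right-hand side is exactly
  \<open>8 / 3 / 2 ^ (m + 3)\<close>. Equality is thus possible at \<open>m = n - 3\<close>, and a
  strict inequality has to come from elsewhere.\<close>

lemma adjacent_mass_bound:
  assumes "6 \<le> n" "1 \<le> m" "m + 3 \<le> n"
  shows "8 / 3 / 2 ^ n \<le> mass m * mass (m + 1) / (mass m + mass (m + 1))"
proof (cases "4 \<le> m")
  case True
  have "(2::real) ^ (m + 3) \<le> 2 ^ n"
    using assms by (intro power_increasing) auto
  then have "8 / 3 / 2 ^ n \<le> 8 / 3 / (2::real) ^ (m + 3)"
    by (intro divide_left_mono) auto
  also have "\<dots> = mass m * mass (m + 1) / (mass m + mass (m + 1))"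
    using True by (simp add: mass_tail field_simps power_add)
  finally show ?thesis .
next
  case False
  \<comment> \<open>The left-hand side is largest at \<open>n = 6\<close>, where it is 1/24; the
    pairs \<open>m = 1, 2, 3\<close> give 1/12, 1/6 and 1/18.\<close>
  have "(2::real) ^ 6 \<le> 2 ^ n"
    using assms by (intro power_increasing) auto
  then have "8 / 3 / 2 ^ n \<le> 8 / 3 / (2::real) ^ 6"
    by (intro divide_left_mono) auto
  also have "\<dots> = 1 / 24" by simp
  also have "\<dots> \<le> mass m * mass (m + 1) / (mass m + mass (m + 1))"
  proof -
    consider "m = 1" | "m = 2" | "m = 3" using False assms by linarith
    then show ?thesis by cases (simp_all add: mass_def)
  qed
  finally show ?thesis .
qed

section \<open>Exchange argument: moving a point onto a missing atom\<close>

lemma optimal_shared_point: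
  assumes opt: "optimal_n_means n P_measure \<alpha>" and fin_err: "quantization_error n P_measure < \<top>"
    and k: "1 \<le> k" "real k \<notin> \<alpha>"
  obtains a j where "a \<in> \<alpha>" "1 \<le> j" "j \<noteq> k"
    "\<And>b. b \<in> \<alpha> \<Longrightarrow> \<bar>real k - a\<bar> \<le> \<bar>real k - b\<bar>"
    "\<And>b. b \<in> \<alpha> \<Longrightarrow> \<bar>real j - a\<bar> \<le> \<bar>real j - b\<bar>"
proof -
  have fin: "finite \<alpha>" "\<alpha> \<noteq> {}" and card: "card \<alpha> \<le> n"
    and err: "distortion_error P_measure \<alpha> = quantization_error n P_measure"
    using opt by (auto simp: optimal_n_means_def)
  obtain a where a: "a \<in> \<alpha>" "sq_dist \<alpha> (real k) = (real k - a)\<^sup>2"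
    using sq_dist_attained[OF fin] by blast
  have near: "\<bar>real k - a\<bar> \<le> \<bar>real k - b\<bar>" if "b \<in> \<alpha>" for b
    using sq_dist_le[OF fin(1) that, of "real k"] a(2) by (simp add: abs_le_square_iff)
  show ?thesis
  proof (cases "\<exists>j\<ge>1. j \<noteq> k \<and> (\<forall>b\<in>\<alpha>. \<bar>real j - a\<bar> \<le> \<bar>real j - b\<bar>)")
    case True
    with that a(1) near show ?thesis by blast
  next
    case False
    \<comment> \<open>The point \<open>a\<close> moves to \<open>k\<close>; the cardinality is kept
      because \<open>k\<close> was not in \<open>\<alpha>\<close>.\<close>
    define \<gamma> where "\<gamma> = insert (real k) (\<alpha> - {a})"
    have fing: "finite \<gamma>" "\<gamma> \<noteq> {}" using fin by (auto simp: \<gamma>_def)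
    have "card \<gamma> = card \<alpha>"
      using card_Suc_Diff1[OF fin(1) a(1)] fin k(2) unfolding \<gamma>_def
      by (simp del: card_Diff_insert)
    then have opt_le: "distortion_error P_measure \<alpha> \<le> distortion_error P_measure \<gamma>"
      using quantization_error_le[OF fing, of n P_measure] card err by simp
    define F where "F j = ennreal (mass j * sq_dist \<alpha> (real j))" for j
    define G where "G j = ennreal (mass j * sq_dist \<gamma> (real j))" for j
    \<comment> \<open>For \<open>j \<ge> 1\<close> the point \<open>a\<close> is not nearest to
      \<open>j\<close>, so a nearest point of \<open>j\<close> survives in \<open>\<gamma>\<close>.
      The index 0 has mass 0.\<close>
    have le: "G j \<le> F j" if "j \<noteq> k" for j
    proof (cases "j = 0")
      case nz: False
      obtain b where b: "b \<in> \<alpha>" "sq_dist \<alpha> (real j) = (real j - b)\<^sup>2"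
        using sq_dist_attained[OF fin] by blast
      have "1 \<le> j" using nz by simp
      with False that have "\<not> (\<forall>b\<in>\<alpha>. \<bar>real j - a\<bar> \<le> \<bar>real j - b\<bar>)" by blast
      then obtain c where "c \<in> \<alpha>" "\<bar>real j - c\<bar> < \<bar>real j - a\<bar>"
        by (meson not_le)
      moreover have "\<bar>real j - b\<bar> \<le> \<bar>real j - c\<bar>"
        using sq_dist_le[OF fin(1) \<open>c \<in> \<alpha>\<close>, of "real j"] b(2) by (simp add: abs_le_square_iff)
      ultimately have "b \<in> \<gamma>" using b(1) by (auto simp: \<gamma>_def)
      then have "sq_dist \<gamma> (real j) \<le> sq_dist \<alpha> (real j)"
        using sq_dist_le[OF fing(1)] b(2) by simp
      then show ?thesis
        unfolding F_def G_def by (intro ennreal_leI mult_left_mono) auto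
    qed (simp add: F_def G_def)
    have Gk: "G k = 0"
      using sq_dist_le[OF fing(1), of "real k" "real k"]
      by (simp add: G_def \<gamma>_def mult_nonneg_nonpos ennreal_neg)
    have Fk: "0 < F k"
      using k sq_dist_pos[OF fin k(2)] mass_pos[of k] by (simp add: F_def)
    \<comment> \<open>Setting the term at \<open>k\<close> to zero isolates \<open>F k\<close>, the
      strict gain of the exchange.\<close>
    define F' where "F' = F(k := 0)"
    have "(\<Sum>j. F j) = (\<Sum>j. F' j + (if j = k then F k else 0))"
      by (intro suminf_cong) (simp add: F'_def)
    also have "\<dots> = (\<Sum>j. F' j) + (\<Sum>j. if j = k then F k else 0)"
      by (intro suminf_add[symmetric]) auto
    also have "(\<Sum>j. if j = k then F k else 0) = F k"
      using sums_single[of k "\<lambda>_. F k"] by (simp add: sums_iff)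
    finally have split: "(\<Sum>j. F j) = (\<Sum>j. F' j) + F k" .
    have "(\<Sum>j. G j) \<le> (\<Sum>j. F' j)"
      using le Gk by (intro suminf_le) (auto simp: F'_def)
    moreover have F: "(\<Sum>j. F j) = distortion_error P_measure \<alpha>"
      and "(\<Sum>j. G j) = distortion_error P_measure \<gamma>"
      by (simp_all add: F_def G_def distortion_error_P_measure fin fing)
    ultimately have "(\<Sum>j. F' j) + F k \<le> (\<Sum>j. F' j)"
      using opt_le split by simp
    \<comment> \<open>Finiteness allows cancelling the common sum in \<open>ennreal\<close>; with
      the value \<open>\<top>\<close> the inequality would be no contradiction.\<close>
    moreover have "(\<Sum>j. F' j) < \<top>"
      using split F err fin_err by (metis ennreal_add_less_top)
    ultimately have False
      using Fk by (metis add.right_neutral ennreal_add_left_cancel_less leD top.not_eq_extremum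
          infinity_ennreal_def)
    then show ?thesis ..
  qed
qed

section \<open>Lower bound for a set that misses an atom up to \<open>n - 3\<close>\<close>

theorem proposition3p3p1:
  fixes n :: nat and \<alpha> :: "real set"
  assumes "n \<ge> 6"
    and "optimal_n_means n P_measure \<alpha>"
  shows "real ` {1..n - 3} \<subseteq> \<alpha>"
proof (rule ccontr)
  have fin: "finite \<alpha>" "\<alpha> \<noteq> {}"
    and err: "distortion_error P_measure \<alpha> = quantization_error n P_measure"
    using assms by (auto simp: optimal_n_means_def)
  have upper: "quantization_error n P_measure \<le> ennreal (8 / 3 / 2 ^ n)"
    using assms by (intro quantization_error_P_measure_le)
  assume "\<not> real ` {1..n - 3} \<subseteq> \<alpha>"
  then obtain k where k: "1 \<le> k" "k \<le> n - 3" "real k \<notin> \<alpha>"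
    by (meson atLeastAtMost_iff image_subsetI)
  obtain a j where a: "a \<in> \<alpha>" and j: "1 \<le> j" "j \<noteq> k"
    and near_k: "\<And>b. b \<in> \<alpha> \<Longrightarrow> \<bar>real k - a\<bar> \<le> \<bar>real k - b\<bar>"
    and near_j: "\<And>b. b \<in> \<alpha> \<Longrightarrow> \<bar>real j - a\<bar> \<le> \<bar>real j - b\<bar>"
    using optimal_shared_point[OF assms(2) _ k(1,3)] upper
    by (metis ennreal_less_top order.strict_trans1)
  \<comment> \<open>The pair \<open>m\<close>, \<open>m + 1\<close> consists of \<open>k\<close> and
    its neighbour on the side of \<open>j\<close>, so both lie between \<open>k\<close> and
    \<open>j\<close>. For \<open>j < k\<close>, \<open>1 \<le> j\<close> ensures
    \<open>1 \<le> m\<close>.\<close>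
  define m where "m = (if k < j then k else k - 1)"
  have m: "1 \<le> m" "m + 3 \<le> n" using k j assms(1) by (auto simp: m_def)
  \<comment> \<open>The Voronoi cell of \<open>a\<close>, where \<open>a\<close> is a nearest point
    of \<open>\<alpha>\<close>, is convex, so it contains everything between \<open>k\<close> and
    \<open>j\<close>.\<close>
  have near_between: "\<bar>x - a\<bar> \<le> \<bar>x - b\<bar>"
    if "min (real k) (real j) \<le> x" "x \<le> max (real k) (real j)" "b \<in> \<alpha>" for x b
    using near_k[OF that(3)] near_j[OF that(3)] that(1,2) by (smt (verit))
  have dist_m: "sq_dist \<alpha> (real m) = (real m - a)\<^sup>2"
    and dist_Suc_m: "sq_dist \<alpha> (real (m + 1)) = (real (m + 1) - a)\<^sup>2"
    using j k by (intro sq_dist_nearest[OF fin(1) a] near_between; auto simp: m_def)+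
  \<comment> \<open>A finite set misses some atom beyond \<open>m + 1\<close>. Its positive cost
    supplies the strictness that the pair bound lacks.\<close>
  have "infinite (real ` {m + 2..})"
    by (auto simp: finite_image_iff infinite_Ici)
  then obtain l where l: "m + 2 \<le> l" "real l \<notin> \<alpha>"
    using fin(1) finite_subset by (metis atLeast_iff image_subsetI)
  have "8 / 3 / 2 ^ n \<le> mass m * mass (m + 1) / (mass m + mass (m + 1))"
    using assms(1) m by (rule adjacent_mass_bound)
  also have "\<dots> \<le> mass m * (real m - a)\<^sup>2 + mass (m + 1) * ((real m - a) + 1)\<^sup>2"
    using m by (intro pair_cost_ge mass_pos) auto
  also have "\<dots> < \<dots> + mass l * sq_dist \<alpha> (real l)"
    using l m sq_dist_pos[OF fin l(2)] mass_pos[of l] by simp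
  also have "\<dots> = (\<Sum>j\<in>{m, m + 1, l}. mass j * sq_dist \<alpha> (real j))"
    using l dist_m dist_Suc_m by (simp add: algebra_simps)
  finally have "ennreal (8 / 3 / 2 ^ n) <
      ennreal (\<Sum>j\<in>{m, m + 1, l}. mass j * sq_dist \<alpha> (real j))"
    by (intro ennreal_lessI) (auto intro: order.strict_trans1[rotated])
  also have "\<dots> \<le> ennreal (8 / 3 / 2 ^ n)"
    using order.trans[OF distortion_error_ge_sum[OF fin, of "{m, m + 1, l}"]] err upper
    by (simp only: finite.intros)
  finally show False by simp
qed

end
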